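(* Let $\{X_n\}_{n\in\mathbb{Z}}$ be a zero-mean, regular, real-valued, discrete-time wide sense stationary process with finite second moment and unit-variance innovation process $\{\nu_n\}_{n\in\mathbb{Z}}$, and let $X_n=\sum_{k=0}^\infty a_k\nu_{n-k}$ (with $a_0=1$, $\sum_{k=0}^\infty|a_k|^2<\infty$) be its Wold decomposition. For $p\in\mathbb{N}$ let $\hat{X}_{n,p}=\sum_{k=0}^p a_k\nu_{n-k}$ be the moving average approximation of order $p$ of $X_n$. Let $S_X$ and $S_{\hat{X}_p}$ denote the spectral densities of $\{X_n\}_{n\in\mathbb{Z}}$ and $\{\hat{X}_{n,p}\}_{n\in\mathbb{Z}}$ respectively. If $\sum_{k=0}^\infty|a_k|<\infty$, then $S_{\hat{X}_p}$ converges to $S_X$ in $L_2$ as $p\to\infty$, i.e. $$\lim_{p\to\infty}\left(\int_{-1/2}^{1/2}\left|S_X(\lambda)-S_{\hat{X}_p}(\lambda)\right|^2d\lambda\right)^{1/2}=0.$$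
   Context: All random variables are real-valued, have zero mean and lie in the Hilbert space $L_2(\mathbb{P})$ of square-integrable random variables on a probability space, with inner product $\mathbb{E}[XY]$. For a wide sense stationary (WSS) process with covariance sequence $R_k=\mathbb{E}[X_{n+k}X_n]$, the spectral density is $S(\lambda)=\sum_{k\in\mathbb{Z}}R_ke^{-2\pi i\lambda k}$, $\lambda\in(-\tfrac12,\tfrac12]$. $H_n$ denotes the closed linear span of $\{X_n,X_{n-1},X_{n-2},\ldots\}$ in $L_2(\mathbb{P})$, and $\overline{\mathbb{E}}[Y|H_n]$ denotes the orthogonal projection of $Y$ onto $H_n$. The process is regular (purely nondeterministic) if $\bigcap_n H_n=\{0\}$. The innovation process is $\nu_n=X_n-\overline{\mathbb{E}}[X_n|H_{n-1}]$; it satisfies $\mathbb{E}[\nu_n]=0$ and $\mathbb{E}[\nu_n\nu_k]=\sigma^2\delta_{n-k}$, and it is assumed (normalization) that $\sigma^2=1$. The Wold decomposition of a regular process is $X_n=\sum_{k=0}^\infty a_k\nu_{n-k}$ with $a_0=1$ and $\sum_{k=0}^\infty|a_k|^2<\infty$. *)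

theory Defs
  imports "HOL-Probability.Probability"
begin

text \<open>Elements of \<open>L2 M\<close> are functions, not classes modulo equality almost everywhere.
  Accordingly, a closed span contains all versions of each of its members, and being zero or being
  a projection is only meant up to null sets.\<close>

definition L2 :: "'a measure \<Rightarrow> ('a \<Rightarrow> 'b::{banach, second_countable_topology}) set" where
  "L2 M = {f \<in> borel_measurable M. integrable M (\<lambda>\<omega>. (norm (f \<omega>))\<^sup>2)}"

definition L2_norm :: "'a measure \<Rightarrow> ('a \<Rightarrow> 'b::{banach, second_countable_topology}) \<Rightarrow> real" where
  "L2_norm M f = sqrt (\<integral>\<omega>. (norm (f \<omega>))\<^sup>2 \<partial>M)"

definition wide_sense_stationary :: "'a measure \<Rightarrow> (int \<Rightarrow> 'a \<Rightarrow> real) \<Rightarrow> bool" where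
  "wide_sense_stationary M X \<longleftrightarrow>
     (\<forall>n. X n \<in> L2 M) \<and>
     (\<forall>m n. (\<integral>\<omega>. X m \<omega> \<partial>M) = (\<integral>\<omega>. X n \<omega> \<partial>M)) \<and>
     (\<forall>m n k. (\<integral>\<omega>. X (m + k) \<omega> * X m \<omega> \<partial>M) = (\<integral>\<omega>. X (n + k) \<omega> * X n \<omega> \<partial>M))"

definition past_lin_span :: "(int \<Rightarrow> 'a \<Rightarrow> real) \<Rightarrow> int \<Rightarrow> ('a \<Rightarrow> real) set" where
  "past_lin_span X n = {(\<lambda>\<omega>. \<Sum>j\<in>J. c j * X j \<omega>) | J c. finite J \<and> J \<subseteq> {..n}}"

definition past_space :: "'a measure \<Rightarrow> (int \<Rightarrow> 'a \<Rightarrow> real) \<Rightarrow> int \<Rightarrow> ('a \<Rightarrow> real) set" where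
  "past_space M X n =
     {Y \<in> L2 M. \<forall>\<epsilon>>0. \<exists>Z \<in> past_lin_span X n. L2_norm M (\<lambda>\<omega>. Y \<omega> - Z \<omega>) < \<epsilon>}"

definition is_orthogonal_projection ::
  "'a measure \<Rightarrow> ('a \<Rightarrow> real) set \<Rightarrow> ('a \<Rightarrow> real) \<Rightarrow> ('a \<Rightarrow> real) \<Rightarrow> bool" where
  "is_orthogonal_projection M H Y P \<longleftrightarrow>
     P \<in> H \<and> (\<forall>W \<in> H. (\<integral>\<omega>. (Y \<omega> - P \<omega>) * W \<omega> \<partial>M) = 0)"

definition regular_process :: "'a measure \<Rightarrow> (int \<Rightarrow> 'a \<Rightarrow> real) \<Rightarrow> bool" where
  "regular_process M X \<longleftrightarrow> (\<forall>Y \<in> (\<Inter>n. past_space M X n). AE \<omega> in M. Y \<omega> = 0)"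

definition innovation_process ::
  "'a measure \<Rightarrow> (int \<Rightarrow> 'a \<Rightarrow> real) \<Rightarrow> (int \<Rightarrow> 'a \<Rightarrow> real) \<Rightarrow> bool" where
  "innovation_process M X \<nu> \<longleftrightarrow>
     (\<forall>n. \<exists>P. is_orthogonal_projection M (past_space M X (n - 1)) (X n) P \<and>
              \<nu> n = (\<lambda>\<omega>. X n \<omega> - P \<omega>))"

definition moving_average ::
  "(nat \<Rightarrow> real) \<Rightarrow> (int \<Rightarrow> 'a \<Rightarrow> real) \<Rightarrow> nat \<Rightarrow> int \<Rightarrow> 'a \<Rightarrow> real" where
  "moving_average a \<nu> p n = (\<lambda>\<omega>. \<Sum>k\<le>p. a k * \<nu> (n - int k) \<omega>)"

definition wold_decomposition ::
  "'a measure \<Rightarrow> (int \<Rightarrow> 'a \<Rightarrow> real) \<Rightarrow> (int \<Rightarrow> 'a \<Rightarrow> real) \<Rightarrow> (nat \<Rightarrow> real) \<Rightarrow> bool" where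
  "wold_decomposition M X \<nu> a \<longleftrightarrow>
     a 0 = 1 \<and> summable (\<lambda>k. \<bar>a k\<bar>\<^sup>2) \<and>
     (\<forall>n. (\<lambda>N. L2_norm M (\<lambda>\<omega>. X n \<omega> - moving_average a \<nu> N n \<omega>)) \<longlonglongrightarrow> 0)"

text \<open>For a zero-mean wide sense stationary process the choice of the base time 0 is immaterial.\<close>

definition covariance_seq :: "'a measure \<Rightarrow> (int \<Rightarrow> 'a \<Rightarrow> real) \<Rightarrow> int \<Rightarrow> real" where
  "covariance_seq M X k = (\<integral>\<omega>. X (0 + k) \<omega> * X 0 \<omega> \<partial>M)"

definition spectral_term :: "'a measure \<Rightarrow> (int \<Rightarrow> 'a \<Rightarrow> real) \<Rightarrow> real \<Rightarrow> int \<Rightarrow> complex" where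
  "spectral_term M X x k =
     complex_of_real (covariance_seq M X k) *
       exp (- 2 * complex_of_real pi * \<i> * complex_of_real x * of_int k)"

text \<open>The sum over the integers is unconditional; \<open>infsum\<close> is 0 if the series is not summable.\<close>

definition spectral_density :: "'a measure \<Rightarrow> (int \<Rightarrow> 'a \<Rightarrow> real) \<Rightarrow> real \<Rightarrow> complex" where
  "spectral_density M X x = (\<Sum>\<^sub>\<infinity>k\<in>UNIV. spectral_term M X x k)"

end

theory Submission imports Defs begin

text \<open>
  A linear filter with absolutely summable real coefficients \<open>a\<close>, driven by orthonormal noise, has
  spectral density \<open>\<bar>A(x)\<bar>\<^sup>2\<close>, where \<open>A(x) = \<Sum>n. a n * exp (- 2 \<pi> \<i> n x)\<close> is its transfer
  function. Both \<open>X\<close> and its moving averages are of this kind: the former with coefficients \<open>a\<close>,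
  the latter with \<open>a\<close> cut off after index \<open>p\<close>. The transfer functions therefore differ by at most
  the tail \<open>\<Sum>k>p. \<bar>a k\<bar>\<close>, uniformly in \<open>x\<close>. As they are bounded by \<open>\<Sum>k. \<bar>a k\<bar>\<close>, the spectral
  densities converge uniformly too, and on an interval of length one uniform convergence implies
  convergence in \<open>L\<^sub>2\<close>.

  That both processes are of this kind is a statement about covariances. The innovations are
  orthogonal because each one lies in the past of every later one (\<open>innovations_orthogonal\<close>). The
  covariance of a moving average at lag \<open>k\<close> is then the finite sum of \<open>a i * a j\<close> over the pairs
  with \<open>i - j = k\<close> and \<open>i, j \<le> p\<close>. The Wold decomposition converges in mean square and the
  inner product is continuous, so the covariance of \<open>X\<close> is the limit of these sums, namely the full
  autocorrelation of \<open>a\<close> (\<open>covariance_Wold\<close>).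

  The factorization of the Fourier series of the autocorrelation as \<open>\<bar>A(x)\<bar>\<^sup>2\<close> is a rearrangement of
  one absolutely convergent double series over pairs \<open>(i, j)\<close>: summed over rows it is the
  product of \<open>A(x)\<close> and its conjugate, summed over the diagonals \<open>i - j = k\<close> it is the Fourier
  series (\<open>autocorrelation_Fourier_has_sum\<close>). This also gives the unconditional summability of
  the series that defines the spectral density.
\<close>

section \<open>Square-integrable functions\<close>

lemma L2_real_iff:
  fixes f :: "'a \<Rightarrow> real"
  shows "f \<in> L2 M \<longleftrightarrow> f \<in> borel_measurable M \<and> integrable M (\<lambda>\<omega>. (f \<omega>)\<^sup>2)"
  by (simp add: L2_def)

lemma integrable_L2_mult:
  fixes f g :: "'a \<Rightarrow> real"
  assumes "f \<in> L2 M" "g \<in> L2 M"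
  shows "integrable M (\<lambda>\<omega>. f \<omega> * g \<omega>)"
proof (rule Bochner_Integration.integrable_bound)
  show "integrable M (\<lambda>\<omega>. (f \<omega>)\<^sup>2 + (g \<omega>)\<^sup>2)"
    using assms by (auto simp: L2_real_iff)
  show "(\<lambda>\<omega>. f \<omega> * g \<omega>) \<in> borel_measurable M"
    using assms by (auto simp: L2_real_iff)
  have "\<bar>x * y\<bar> \<le> x\<^sup>2 + y\<^sup>2" for x y :: real
  proof -
    have "0 \<le> (\<bar>x\<bar> - \<bar>y\<bar>)\<^sup>2" by simp
    then have "2 * (\<bar>x\<bar> * \<bar>y\<bar>) \<le> x\<^sup>2 + y\<^sup>2"
      by (simp add: power2_eq_square algebra_simps)
    moreover have "0 \<le> \<bar>x\<bar> * \<bar>y\<bar>" by simp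
    ultimately show ?thesis by (simp only: abs_mult)
  qed
  then show "AE \<omega> in M. norm (f \<omega> * g \<omega>) \<le> norm ((f \<omega>)\<^sup>2 + (g \<omega>)\<^sup>2)"
    by auto
qed

lemma L2_cmult:
  fixes f :: "'a \<Rightarrow> real"
  shows "f \<in> L2 M \<Longrightarrow> (\<lambda>\<omega>. c * f \<omega>) \<in> L2 M"
  by (auto simp: L2_real_iff power_mult_distrib)

lemma L2_add:
  fixes f g :: "'a \<Rightarrow> real"
  assumes "f \<in> L2 M" "g \<in> L2 M"
  shows "(\<lambda>\<omega>. f \<omega> + g \<omega>) \<in> L2 M"
  using assms integrable_L2_mult[OF assms]
  by (auto simp: L2_real_iff power2_sum mult.assoc)

lemma L2_diff:
  fixes f g :: "'a \<Rightarrow> real"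
  assumes "f \<in> L2 M" "g \<in> L2 M"
  shows "(\<lambda>\<omega>. f \<omega> - g \<omega>) \<in> L2 M"
  using L2_add[OF assms(1) L2_cmult[OF assms(2), of "-1"]] by simp

lemma L2_sum:
  fixes f :: "'i \<Rightarrow> 'a \<Rightarrow> real"
  assumes "\<And>i. i \<in> I \<Longrightarrow> f i \<in> L2 M"
  shows "(\<lambda>\<omega>. \<Sum>i\<in>I. f i \<omega>) \<in> L2 M"
  using assms
proof (induction I rule: infinite_finite_induct)
  case (insert i I)
  then show ?case by (simp add: L2_add)
qed (simp_all add: L2_real_iff)

text \<open>The quadratic polynomial \<open>\<integral>(f - t g)\<^sup>2\<close> in \<open>t\<close> is nonnegative, so it has a nonpositive
  discriminant.\<close>

lemma Cauchy_Schwarz_L2: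
  fixes f g :: "'a \<Rightarrow> real"
  assumes f: "f \<in> L2 M" and g: "g \<in> L2 M"
  shows "\<bar>\<integral>\<omega>. f \<omega> * g \<omega> \<partial>M\<bar> \<le> L2_norm M f * L2_norm M g"
proof -
  define A where "A = (\<integral>\<omega>. (f \<omega>)\<^sup>2 \<partial>M)"
  define B where "B = (\<integral>\<omega>. (g \<omega>)\<^sup>2 \<partial>M)"
  define C where "C = (\<integral>\<omega>. f \<omega> * g \<omega> \<partial>M)"
  have int: "integrable M (\<lambda>\<omega>. (f \<omega>)\<^sup>2)" "integrable M (\<lambda>\<omega>. (g \<omega>)\<^sup>2)"
    "integrable M (\<lambda>\<omega>. f \<omega> * g \<omega>)"
    using f g integrable_L2_mult[OF f g] by (auto simp: L2_real_iff)
  have quad: "0 \<le> A - 2 * t * C + t\<^sup>2 * B" for t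
  proof -
    have "0 \<le> (\<integral>\<omega>. (f \<omega> - t * g \<omega>)\<^sup>2 \<partial>M)" by simp
    also have "\<dots> = (\<integral>\<omega>. (f \<omega>)\<^sup>2 - (2 * t) * (f \<omega> * g \<omega>) + t\<^sup>2 * (g \<omega>)\<^sup>2 \<partial>M)"
      by (intro Bochner_Integration.integral_cong) (auto simp: power2_eq_square algebra_simps)
    also have "\<dots> = A - 2 * t * C + t\<^sup>2 * B"
      using int by (simp add: A_def B_def C_def)
    finally show ?thesis .
  qed
  have A0: "0 \<le> A" and B0: "0 \<le> B" by (simp_all add: A_def B_def)
  \<comment> \<open>If \<open>B > 0\<close>, the minimum is at \<open>t = C / B\<close>. If \<open>B = 0\<close>, the polynomial is affine, and it is \<open>-1\<close>
    at the stated \<open>t\<close> unless \<open>C = 0\<close>.\<close>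
  have "C\<^sup>2 \<le> A * B"
  proof (cases "B = 0")
    case True
    have "C = 0"
    proof (rule ccontr)
      assume "C \<noteq> 0"
      then show False
        using quad[of "(A + 1) / (2 * C)"] True by simp
    qed
    then show ?thesis using A0 B0 by simp
  next
    case False
    then have "B > 0" using B0 by simp
    then show ?thesis
      using quad[of "C / B"] by (simp add: field_simps power2_eq_square)
  qed
  then have "\<bar>C\<bar> \<le> sqrt (A * B)"
    by (simp add: real_le_rsqrt)
  then show ?thesis
    by (simp add: L2_norm_def A_def B_def C_def real_sqrt_mult)
qed

text \<open>Continuity of the inner product carries the covariances of the moving averages over to
  their mean square limit.\<close>

lemma tendsto_inner_L2:
  fixes U V :: "'a \<Rightarrow> real" and u v :: "nat \<Rightarrow> 'a \<Rightarrow> real"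
  assumes UV: "U \<in> L2 M" "V \<in> L2 M" and uv: "\<And>N. u N \<in> L2 M" "\<And>N. v N \<in> L2 M"
    and u: "(\<lambda>N. L2_norm M (\<lambda>\<omega>. U \<omega> - u N \<omega>)) \<longlonglongrightarrow> 0"
    and v: "(\<lambda>N. L2_norm M (\<lambda>\<omega>. V \<omega> - v N \<omega>)) \<longlonglongrightarrow> 0"
  shows "(\<lambda>N. \<integral>\<omega>. u N \<omega> * v N \<omega> \<partial>M) \<longlonglongrightarrow> (\<integral>\<omega>. U \<omega> * V \<omega> \<partial>M)"
proof -
  define \<delta> where "\<delta> N = L2_norm M (\<lambda>\<omega>. U \<omega> - u N \<omega>)" for N
  define \<eta> where "\<eta> N = L2_norm M (\<lambda>\<omega>. V \<omega> - v N \<omega>)" for N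
  have "norm ((\<integral>\<omega>. u N \<omega> * v N \<omega> \<partial>M) - (\<integral>\<omega>. U \<omega> * V \<omega> \<partial>M))
      \<le> \<delta> N * \<eta> N + \<delta> N * L2_norm M V + L2_norm M U * \<eta> N" for N
  proof -
    have d: "(\<lambda>\<omega>. U \<omega> - u N \<omega>) \<in> L2 M" "(\<lambda>\<omega>. V \<omega> - v N \<omega>) \<in> L2 M"
      using UV uv by (auto intro: L2_diff)
    \<comment> \<open>Expanding around the limits keeps the norms of the approximants out of the estimate.\<close>
    have "(\<integral>\<omega>. u N \<omega> * v N \<omega> \<partial>M)
        = (\<integral>\<omega>. U \<omega> * V \<omega> + (U \<omega> - u N \<omega>) * (V \<omega> - v N \<omega>)
            - (U \<omega> - u N \<omega>) * V \<omega> - U \<omega> * (V \<omega> - v N \<omega>) \<partial>M)"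
      by (intro Bochner_Integration.integral_cong) (auto simp: algebra_simps)
    also have "\<dots> = (\<integral>\<omega>. U \<omega> * V \<omega> \<partial>M)
        + (\<integral>\<omega>. (U \<omega> - u N \<omega>) * (V \<omega> - v N \<omega>) \<partial>M)
        - (\<integral>\<omega>. (U \<omega> - u N \<omega>) * V \<omega> \<partial>M) - (\<integral>\<omega>. U \<omega> * (V \<omega> - v N \<omega>) \<partial>M)"
      using integrable_L2_mult[OF UV] integrable_L2_mult[OF d]
        integrable_L2_mult[OF d(1) UV(2)] integrable_L2_mult[OF UV(1) d(2)]
      by (simp only: Bochner_Integration.integral_add Bochner_Integration.integral_diff
          Bochner_Integration.integrable_add Bochner_Integration.integrable_diff)
    finally show ?thesis
      using Cauchy_Schwarz_L2[OF d] Cauchy_Schwarz_L2[OF d(1) UV(2)]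
        Cauchy_Schwarz_L2[OF UV(1) d(2)]
      unfolding \<delta>_def \<eta>_def real_norm_def by linarith
  qed
  moreover have "(\<lambda>N. \<delta> N * \<eta> N + \<delta> N * L2_norm M V + L2_norm M U * \<eta> N) \<longlonglongrightarrow> 0"
    using u v unfolding \<delta>_def[symmetric] \<eta>_def[symmetric]
    by (intro tendsto_add_zero tendsto_mult_zero tendsto_mult_left_zero tendsto_mult_right_zero)
  ultimately have "(\<lambda>N. (\<integral>\<omega>. u N \<omega> * v N \<omega> \<partial>M) - (\<integral>\<omega>. U \<omega> * V \<omega> \<partial>M)) \<longlonglongrightarrow> 0"
    by (rule Lim_null_comparison[OF always_eventually[OF allI]])
  then show ?thesis
    by (rule LIM_zero_cancel)
qed

section \<open>Orthonormality of the innovations\<close>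

lemma past_space_mono:
  assumes "m \<le> n"
  shows "past_space M X m \<subseteq> past_space M X n"
proof -
  have "past_lin_span X m \<subseteq> past_lin_span X n"
  proof
    fix Z assume "Z \<in> past_lin_span X m"
    then obtain J c where Z: "Z = (\<lambda>\<omega>. \<Sum>j\<in>J. c j * X j \<omega>)" and J: "finite J" "J \<subseteq> {..m}"
      unfolding past_lin_span_def by blast
    have "J \<subseteq> {..n}" using J(2) assms by auto
    with Z J(1) show "Z \<in> past_lin_span X n" unfolding past_lin_span_def by blast
  qed
  then show ?thesis unfolding past_space_def by blast
qed

lemma diff_in_past_lin_span:
  assumes "Z \<in> past_lin_span X (n - 1)"
  shows "(\<lambda>\<omega>. X n \<omega> - Z \<omega>) \<in> past_lin_span X n"
proof -
  obtain J c where Z: "Z = (\<lambda>\<omega>. \<Sum>j\<in>J. c j * X j \<omega>)" and J: "finite J" "J \<subseteq> {..n - 1}"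
    using assms unfolding past_lin_span_def by blast
  define d where "d = (\<lambda>j. - c j)(n := 1)"
  have n: "n \<notin> J" using J by auto
  have "X n \<omega> - Z \<omega> = (\<Sum>j\<in>insert n J. d j * X j \<omega>)" for \<omega>
  proof -
    have "(\<Sum>j\<in>J. d j * X j \<omega>) = (\<Sum>j\<in>J. - (c j * X j \<omega>))"
      using n by (intro sum.cong) (auto simp: d_def)
    then show ?thesis
      using n J by (simp add: Z sum_negf d_def)
  qed
  moreover have "finite (insert n J)" "insert n J \<subseteq> {..n}" using J by auto
  ultimately show ?thesis unfolding past_lin_span_def by blast
qed

text \<open>If \<open>Z\<close> approximates the projection of \<open>X n\<close> onto the past up to time \<open>n - 1\<close>, then \<open>X n - Z\<close>
  is a combination of the values up to time \<open>n\<close> that approximates the innovation equally well.\<close>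

lemma innovation_in_past_space:
  assumes "innovation_process M X \<nu>" and X: "\<And>n. X n \<in> L2 M"
  shows "\<nu> n \<in> past_space M X n"
proof -
  obtain P where P: "P \<in> past_space M X (n - 1)" and \<nu>: "\<nu> n = (\<lambda>\<omega>. X n \<omega> - P \<omega>)"
    using assms unfolding innovation_process_def is_orthogonal_projection_def by blast
  have "\<exists>Z\<in>past_lin_span X n. L2_norm M (\<lambda>\<omega>. \<nu> n \<omega> - Z \<omega>) < \<epsilon>" if \<epsilon>: "\<epsilon> > 0" for \<epsilon>
  proof -
    obtain Z where Z: "Z \<in> past_lin_span X (n - 1)" "L2_norm M (\<lambda>\<omega>. P \<omega> - Z \<omega>) < \<epsilon>"
      using P \<epsilon> unfolding past_space_def by blast
    have "L2_norm M (\<lambda>\<omega>. \<nu> n \<omega> - (X n \<omega> - Z \<omega>)) = L2_norm M (\<lambda>\<omega>. P \<omega> - Z \<omega>)"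
      by (simp add: L2_norm_def \<nu> power2_commute)
    with Z(2) diff_in_past_lin_span[OF Z(1)] show ?thesis
      by (intro bexI[where x = "\<lambda>\<omega>. X n \<omega> - Z \<omega>"]) simp_all
  qed
  moreover have "\<nu> n \<in> L2 M"
    using P X unfolding \<nu> past_space_def by (auto intro: L2_diff)
  ultimately show ?thesis unfolding past_space_def by blast
qed

text \<open>The later of two innovations is orthogonal to the whole preceding past, which contains the
  earlier one.\<close>

lemma innovations_orthogonal:
  assumes inn: "innovation_process M X \<nu>" and X: "\<And>n. X n \<in> L2 M" and "m \<noteq> n"
  shows "(\<integral>\<omega>. \<nu> m \<omega> * \<nu> n \<omega> \<partial>M) = 0"
proof -
  have earlier: "(\<integral>\<omega>. \<nu> n \<omega> * \<nu> m \<omega> \<partial>M) = 0" if "m < n" for m n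
  proof -
    have "\<nu> m \<in> past_space M X (n - 1)"
      using innovation_in_past_space[OF inn X] past_space_mono[of m "n - 1"] that by auto
    then show ?thesis
      using inn unfolding innovation_process_def is_orthogonal_projection_def by metis
  qed
  show ?thesis
    using earlier[of m n] earlier[of n m] \<open>m \<noteq> n\<close> by (cases "m < n") (auto simp: mult.commute)
qed

section \<open>Autocorrelation and transfer function of a summable sequence\<close>

definition lag_pairs :: "int \<Rightarrow> (nat \<times> nat) set" where
  "lag_pairs k = {(i, j). int i - int j = k}"

text \<open>Summing over pairs of indices, rather than over one index with the other shifted by \<open>k\<close>,
  treats positive and negative lags alike.\<close>

definition autocorrelation :: "(nat \<Rightarrow> real) \<Rightarrow> int \<Rightarrow> real" where
  "autocorrelation a k = (\<Sum>\<^sub>\<infinity>(i, j)\<in>lag_pairs k. a i * a j)"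

definition transfer_function :: "(nat \<Rightarrow> real) \<Rightarrow> real \<Rightarrow> complex" where
  "transfer_function a x = (\<Sum>n. complex_of_real (a n) * cis (- 2 * pi * x * real n))"

lemma transfer_function_has_sum:
  assumes "summable (\<lambda>k. \<bar>a k\<bar>)"
  shows "((\<lambda>n. complex_of_real (a n) * cis (- 2 * pi * x * real n))
           has_sum transfer_function a x) UNIV"
proof -
  have n: "summable (\<lambda>n. norm (complex_of_real (a n) * cis (- 2 * pi * x * real n)))"
    using assms by (simp add: norm_mult)
  show ?thesis
    unfolding transfer_function_def
    by (rule norm_summable_imp_has_sum[OF n]) (rule summable_sums[OF summable_norm_cancel[OF n]])
qed

lemma abs_summable_on_pairs:
  fixes a :: "nat \<Rightarrow> real"
  assumes "summable (\<lambda>k. \<bar>a k\<bar>)"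
  shows "(\<lambda>z. norm (case z of (i, j) \<Rightarrow> a i * a j)) summable_on UNIV \<times> UNIV"
proof -
  have "(\<lambda>k. norm (a k)) summable_on UNIV"
    using assms by (intro norm_summable_imp_summable_on) simp
  then show ?thesis
    by (intro Infinite_Sum.abs_summable_on_Sigma_iff[THEN iffD2])
      (auto simp: abs_mult infsum_cmult_right' infsum_nonneg
        intro!: summable_on_cmult_right summable_on_cmult_left)
qed

lemma autocorrelation_has_sum:
  assumes "summable (\<lambda>k. \<bar>a k\<bar>)"
  shows "((\<lambda>(i, j). a i * a j) has_sum autocorrelation a k) (lag_pairs k)"
  unfolding autocorrelation_def
  using abs_summable_summable[OF abs_summable_on_pairs[OF assms]]
  by (intro has_sum_infsum) (rule summable_on_subset_banach, auto)

text \<open>On the diagonal \<open>i - j = k\<close> the two exponentials multiply to the constant \<open>exp (- 2 \<pi> \<i> k x)\<close>.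
  Grouping the double series of \<open>A(x)\<close> times its conjugate by diagonals hence leaves the
  autocorrelation at \<open>k\<close> as its coefficient; absolute convergence permits the regrouping.\<close>

lemma autocorrelation_Fourier_has_sum:
  assumes a: "summable (\<lambda>k. \<bar>a k\<bar>)"
  shows "((\<lambda>k. complex_of_real (autocorrelation a k) * cis (- 2 * pi * x * real_of_int k))
           has_sum complex_of_real ((cmod (transfer_function a x))\<^sup>2)) UNIV"
proof -
  define e where "e y = cis (- 2 * pi * x * y)" for y
  define F where "F = (\<lambda>(i, j). complex_of_real (a i * a j) * (e (real i) * cnj (e (real j))))"
  have "(\<lambda>z. cmod (F z)) = (\<lambda>z. norm (case z of (i, j) \<Rightarrow> a i * a j))"
    by (intro ext) (simp add: F_def e_def norm_mult abs_mult split: prod.split)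
  then have F: "(\<lambda>z. norm (F z)) summable_on UNIV \<times> UNIV"
    using abs_summable_on_pairs[OF a] by simp
  have A: "((\<lambda>n. complex_of_real (a n) * e (real n)) has_sum transfer_function a x) UNIV"
    unfolding e_def by (rule transfer_function_has_sum[OF a])
  have A': "((\<lambda>n. cnj (complex_of_real (a n) * e (real n))) has_sum cnj (transfer_function a x)) UNIV"
    by (simp only: has_sum_cnj_iff A)
  have "(F has_sum transfer_function a x * cnj (transfer_function a x)) (UNIV \<times> UNIV)"
  proof (rule has_sum_SigmaI)
    fix i :: nat
    show "((\<lambda>j. F (i, j)) has_sum
        complex_of_real (a i) * e (real i) * cnj (transfer_function a x)) UNIV"
      using has_sum_cmult_right[OF A', of "complex_of_real (a i) * e (real i)"]
      by (simp add: F_def mult_ac)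
  qed (use has_sum_cmult_left[OF A] abs_summable_summable[OF F] in auto)
  \<comment> \<open>The diagonals partition the index pairs.\<close>
  moreover have "bij_betw snd (Sigma UNIV lag_pairs) (UNIV \<times> UNIV)"
    by (rule bij_betw_byWitness[where f' = "\<lambda>(i, j). (int i - int j, i, j)"])
      (auto simp: lag_pairs_def)
  ultimately have "((\<lambda>z. F (snd z)) has_sum transfer_function a x * cnj (transfer_function a x))
      (Sigma UNIV lag_pairs)"
    by (simp only: has_sum_reindex_bij_betw)
  moreover have "((\<lambda>y. F (snd (k, y))) has_sum
      complex_of_real (autocorrelation a k) * e (real_of_int k)) (lag_pairs k)" for k
  proof -
    have "((\<lambda>z. complex_of_real (case z of (i, j) \<Rightarrow> a i * a j) * e (real_of_int k)) has_sum
        complex_of_real (autocorrelation a k) * e (real_of_int k)) (lag_pairs k)"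
      by (intro has_sum_cmult_left has_sum_of_real autocorrelation_has_sum a)
    moreover have "e (real i) * cnj (e (real j)) = e (real_of_int (int i - int j))" for i j
      by (simp add: e_def cis_cnj cis_mult algebra_simps)
    ultimately show ?thesis
      by (elim has_sum_cong[THEN iffD1, rotated]) (auto simp: F_def lag_pairs_def)
  qed
  ultimately have "((\<lambda>k. complex_of_real (autocorrelation a k) * e (real_of_int k))
      has_sum transfer_function a x * cnj (transfer_function a x)) UNIV"
    by (rule has_sum_SigmaD)
  then show ?thesis
    by (simp only: e_def complex_norm_square)
qed

lemma spectral_density_eq_transfer_function:
  assumes "summable (\<lambda>k. \<bar>a k\<bar>)" and "\<And>k. covariance_seq M X k = autocorrelation a k"
  shows "spectral_term M X x summable_on UNIV"
    and "spectral_density M X x = complex_of_real ((cmod (transfer_function a x))\<^sup>2)"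
proof -
  have "spectral_term M X x = (\<lambda>k. complex_of_real (autocorrelation a k)
      * cis (- 2 * pi * x * real_of_int k))"
    by (auto simp: spectral_term_def assms(2) cis_conv_exp mult_ac)
  then have "(spectral_term M X x has_sum complex_of_real ((cmod (transfer_function a x))\<^sup>2)) UNIV"
    using autocorrelation_Fourier_has_sum[OF assms(1), of x] by simp
  then show "spectral_term M X x summable_on UNIV"
    and "spectral_density M X x = complex_of_real ((cmod (transfer_function a x))\<^sup>2)"
    by (auto simp: spectral_density_def summable_on_def infsumI)
qed

lemma norm_transfer_function_le:
  assumes "summable (\<lambda>k. \<bar>a k\<bar>)"
  shows "cmod (transfer_function a x) \<le> (\<Sum>k. \<bar>a k\<bar>)"
proof -
  have "cmod (transfer_function a x)
      \<le> (\<Sum>k. norm (complex_of_real (a k) * cis (- 2 * pi * x * real k)))"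
    unfolding transfer_function_def using assms by (intro summable_norm) (simp add: norm_mult)
  then show ?thesis by (simp add: norm_mult)
qed

lemma transfer_function_diff:
  assumes "summable (\<lambda>k. \<bar>a k\<bar>)" "summable (\<lambda>k. \<bar>b k\<bar>)"
  shows "transfer_function a x - transfer_function b x = transfer_function (\<lambda>k. a k - b k) x"
proof -
  have "summable (\<lambda>n. complex_of_real (c n) * cis (- 2 * pi * x * real n))"
    if "summable (\<lambda>k. \<bar>c k\<bar>)" for c
    by (rule summable_norm_cancel) (simp add: norm_mult that)
  from suminf_diff[OF this[OF assms(1)] this[OF assms(2)]] show ?thesis
    unfolding transfer_function_def of_real_diff left_diff_distrib .
qed

lemma transfer_function_measurable [measurable]: "transfer_function a \<in> borel_measurable borel"
proof -
  have "(\<lambda>x. cis (- 2 * pi * x * real n)) \<in> borel_measurable borel" for n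
    by (intro borel_measurable_continuous_onI continuous_intros)
  then show ?thesis unfolding transfer_function_def by measurable
qed

text \<open>Membership follows from boundedness, the frequency interval having finite measure.\<close>

lemma spectral_density_L2:
  assumes "summable (\<lambda>k. \<bar>a k\<bar>)"
    and "spectral_density M X = (\<lambda>x. complex_of_real ((cmod (transfer_function a x))\<^sup>2))"
  shows "spectral_density M X \<in> L2 (restrict_space lborel {-1/2..1/2})"
proof -
  interpret finite_measure "restrict_space lborel {-1/2..1/2::real}"
    by (rule finite_measureI) (simp add: emeasure_restrict_space space_restrict_space)
  have meas: "spectral_density M X \<in> borel_measurable (restrict_space lborel {-1/2..1/2})"
    unfolding assms(2) by (intro measurable_restrict_space1) simp
  have "integrable (restrict_space lborel {-1/2..1/2}) (\<lambda>x. (norm (spectral_density M X x))\<^sup>2)"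
  proof (rule integrable_const_bound)
    show "AE x in restrict_space lborel {-1/2..1/2}.
        norm ((norm (spectral_density M X x))\<^sup>2) \<le> (((\<Sum>k. \<bar>a k\<bar>)\<^sup>2))\<^sup>2"
      unfolding assms(2) using norm_transfer_function_le[OF assms(1)]
      by (auto simp: norm_power intro!: power_mono)
  qed (use meas in measurable)
  with meas show ?thesis by (simp add: L2_def)
qed

section \<open>Covariances of the process and of its moving averages\<close>

abbreviation truncate_seq :: "nat \<Rightarrow> (nat \<Rightarrow> real) \<Rightarrow> nat \<Rightarrow> real" where
  "truncate_seq p a \<equiv> (\<lambda>k. if k \<le> p then a k else 0)"

lemma moving_average_L2: "(\<And>n. \<nu> n \<in> L2 M) \<Longrightarrow> moving_average a \<nu> p n \<in> L2 M"
  unfolding moving_average_def by (intro L2_sum L2_cmult)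

text \<open>Orthonormality leaves only the products of coefficients that belong to the same innovation:
  \<open>k - i = - j\<close>, that is \<open>i - j = k\<close>.\<close>

lemma covariance_moving_average:
  assumes \<nu>: "\<And>n. \<nu> n \<in> L2 M"
    and orth: "\<And>m n. (\<integral>\<omega>. \<nu> m \<omega> * \<nu> n \<omega> \<partial>M) = (if m = n then 1 else 0)"
  shows "covariance_seq M (moving_average a \<nu> p) k
           = (\<Sum>(i, j)\<in>lag_pairs k \<inter> ({..p} \<times> {..p}). a i * a j)"
proof -
  have int: "integrable M (\<lambda>\<omega>. \<nu> m \<omega> * \<nu> n \<omega>)" for m n
    using \<nu> integrable_L2_mult by blast
  have "covariance_seq M (moving_average a \<nu> p) k
      = (\<integral>\<omega>. (\<Sum>i\<le>p. \<Sum>j\<le>p. (a i * a j) * (\<nu> (k - int i) \<omega> * \<nu> (- int j) \<omega>)) \<partial>M)"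
    unfolding covariance_seq_def moving_average_def sum_product
    by (intro Bochner_Integration.integral_cong sum.cong refl) simp
  also have "\<dots> = (\<Sum>i\<le>p. \<Sum>j\<le>p. (a i * a j) * (if k - int i = - int j then 1 else 0))"
    using int by (simp add: orth)
  also have "\<dots> = (\<Sum>(i, j)\<in>{..p} \<times> {..p}. if (i, j) \<in> lag_pairs k then a i * a j else 0)"
    unfolding sum.cartesian_product by (intro sum.cong) (auto simp: lag_pairs_def)
  also have "\<dots> = (\<Sum>(i, j)\<in>lag_pairs k \<inter> ({..p} \<times> {..p}). a i * a j)"
    by (subst Int_commute, subst sum.inter_restrict) (auto intro!: sum.cong)
  finally show ?thesis .
qed

lemma autocorrelation_truncate:
  "autocorrelation (truncate_seq p a) k = (\<Sum>(i, j)\<in>lag_pairs k \<inter> ({..p} \<times> {..p}). a i * a j)"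
proof -
  have "autocorrelation (truncate_seq p a) k
      = (\<Sum>\<^sub>\<infinity>(i, j)\<in>lag_pairs k \<inter> ({..p} \<times> {..p}). a i * a j)"
    unfolding autocorrelation_def by (rule infsum_cong_neutral) (auto split: if_split_asm)
  then show ?thesis by simp
qed

text \<open>The covariances of the moving averages converge to that of the process by continuity of
  the inner product, and to the autocorrelation because they are its partial sums over squares.\<close>

lemma covariance_Wold:
  assumes \<nu>: "\<And>n. \<nu> n \<in> L2 M" and X: "\<And>n. X n \<in> L2 M"
    and orth: "\<And>m n. (\<integral>\<omega>. \<nu> m \<omega> * \<nu> n \<omega> \<partial>M) = (if m = n then 1 else 0)"
    and wold: "wold_decomposition M X \<nu> a" and a: "summable (\<lambda>k. \<bar>a k\<bar>)"
  shows "covariance_seq M X k = autocorrelation a k"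
proof (rule LIMSEQ_unique)
  show "(\<lambda>p. covariance_seq M (moving_average a \<nu> p) k) \<longlonglongrightarrow> covariance_seq M X k"
    unfolding covariance_seq_def using wold
    by (intro tendsto_inner_L2 X moving_average_L2 \<nu>) (auto simp: wold_decomposition_def)
  \<comment> \<open>The index squares exhaust the pairs with lag \<open>k\<close>, so the covariances of the moving averages
    are values of the net whose limit is the unordered sum.\<close>
  have "filterlim (\<lambda>p. lag_pairs k \<inter> ({..p} \<times> {..p})) (finite_subsets_at_top (lag_pairs k)) sequentially"
    unfolding filterlim_finite_subsets_at_top
  proof (intro allI impI)
    fix Y assume Y: "finite Y \<and> Y \<subseteq> lag_pairs k"
    then obtain N where N: "\<forall>z\<in>Y. max (fst z) (snd z) \<le> N"
      using finite_nat_set_iff_bounded_le[of "(\<lambda>z. max (fst z) (snd z)) ` Y"] by auto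
    have "finite (lag_pairs k \<inter> ({..p} \<times> {..p})) \<and> Y \<subseteq> lag_pairs k \<inter> ({..p} \<times> {..p})
        \<and> lag_pairs k \<inter> ({..p} \<times> {..p}) \<subseteq> lag_pairs k" if "p \<ge> N" for p
      using N Y that by fastforce
    then show "\<forall>\<^sub>F p in sequentially. finite (lag_pairs k \<inter> ({..p} \<times> {..p}))
        \<and> Y \<subseteq> lag_pairs k \<inter> ({..p} \<times> {..p}) \<and> lag_pairs k \<inter> ({..p} \<times> {..p}) \<subseteq> lag_pairs k"
      by (rule eventually_sequentiallyI)
  qed
  then show "(\<lambda>p. covariance_seq M (moving_average a \<nu> p) k) \<longlonglongrightarrow> autocorrelation a k"
    unfolding covariance_moving_average[OF \<nu> orth]
    using autocorrelation_has_sum[OF a, of k] unfolding has_sum_def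
    by (rule filterlim_compose[rotated])
qed

section \<open>Convergence of the spectral densities\<close>

lemma truncation_tail_tendsto_0:
  assumes "summable (\<lambda>k. \<bar>a k\<bar>)"
  shows "(\<lambda>p. \<Sum>k. \<bar>a k - truncate_seq p a k\<bar>) \<longlonglongrightarrow> 0"
proof -
  have "(\<Sum>k. \<bar>a k - truncate_seq p a k\<bar>) = (\<Sum>k. \<bar>a (k + Suc p)\<bar>)" for p
  proof -
    have "summable (\<lambda>k. \<bar>a k - truncate_seq p a k\<bar>)"
      by (rule summable_comparison_test'[OF assms]) auto
    from suminf_split_initial_segment[OF this, of "Suc p"] show ?thesis
      by simp
  qed
  moreover have "(\<lambda>p. \<Sum>k. \<bar>a (k + Suc p)\<bar>) \<longlonglongrightarrow> 0"
    using suminf_exist_split2[OF assms] by (rule LIMSEQ_Suc)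
  ultimately show ?thesis by simp
qed

text \<open>Factoring the difference of squares turns the linear dependence of the transfer function on
  its coefficients into a local Lipschitz estimate for the power spectrum, in terms of the
  \<open>l\<^sub>1\<close> norm and uniformly in the frequency.\<close>

lemma power_spectrum_diff_le:
  assumes a: "summable (\<lambda>k. \<bar>a k\<bar>)" and b: "summable (\<lambda>k. \<bar>b k\<bar>)"
  shows "\<bar>(cmod (transfer_function a x))\<^sup>2 - (cmod (transfer_function b x))\<^sup>2\<bar>
           \<le> (\<Sum>k. \<bar>a k - b k\<bar>) * ((\<Sum>k. \<bar>a k\<bar>) + (\<Sum>k. \<bar>b k\<bar>))"
proof -
  let ?A = "transfer_function a x" and ?B = "transfer_function b x"
  have d: "summable (\<lambda>k. \<bar>a k - b k\<bar>)"
    by (rule summable_comparison_test'[OF summable_add[OF a b]]) auto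
  have "\<bar>(cmod ?A)\<^sup>2 - (cmod ?B)\<^sup>2\<bar> = \<bar>cmod ?A - cmod ?B\<bar> * (cmod ?A + cmod ?B)"
    by (simp add: square_diff_square_factored abs_mult power2_eq_square mult.commute)
  also have "\<dots> \<le> cmod (?A - ?B) * (cmod ?A + cmod ?B)"
    by (intro mult_right_mono norm_triangle_ineq3) simp
  also have "\<dots> \<le> (\<Sum>k. \<bar>a k - b k\<bar>) * ((\<Sum>k. \<bar>a k\<bar>) + (\<Sum>k. \<bar>b k\<bar>))"
    unfolding transfer_function_diff[OF a b]
    by (intro mult_mono add_mono norm_transfer_function_le a b d suminf_nonneg) auto
  finally show ?thesis .
qed

lemma sqrt_integral_unit_interval_le:
  fixes g :: "real \<Rightarrow> real"
  assumes "\<And>x. \<bar>g x\<bar> \<le> B"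
  shows "sqrt (LBINT x:{-1/2..1/2}. (g x)\<^sup>2) \<le> B"
proof (cases "set_integrable lborel {-1/2..1/2} (\<lambda>x. (g x)\<^sup>2)")
  case True
  have "(g x)\<^sup>2 \<le> B\<^sup>2" for x
    using power_mono[OF assms, of x 2] by simp
  then have "(LBINT x:{-1/2..1/2}. (g x)\<^sup>2) \<le> (LBINT x:{-1/2..1/2::real}. B\<^sup>2)"
    using True by (intro set_integral_mono) (auto simp: set_integrable_def)
  also have "\<dots> = B\<^sup>2" by (simp add: set_lebesgue_integral_def)
  finally have "(LBINT x:{-1/2..1/2}. (g x)\<^sup>2) \<le> B\<^sup>2" .
  then show ?thesis
    using assms[of 0] by (intro real_le_lsqrt) auto
next
  case False
  \<comment> \<open>The integral of a function that is not integrable is 0 by convention.\<close>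
  then have "(LBINT x:{-1/2..1/2}. (g x)\<^sup>2) = 0"
    by (simp add: set_lebesgue_integral_def set_integrable_def not_integrable_integral_eq)
  then show ?thesis using assms[of 0] by simp
qed

theorem proposition3p1:
  fixes M :: "'a measure"
    and X \<nu> :: "int \<Rightarrow> 'a \<Rightarrow> real"
    and a :: "nat \<Rightarrow> real"
  assumes "prob_space M"
    and "wide_sense_stationary M X"
    and "\<And>n. (\<integral>\<omega>. X n \<omega> \<partial>M) = 0"
    and "regular_process M X"
    and "innovation_process M X \<nu>"
    and "\<And>n. (\<integral>\<omega>. (\<nu> n \<omega>)\<^sup>2 \<partial>M) = 1"
    and "wold_decomposition M X \<nu> a"
    and "summable (\<lambda>k. \<bar>a k\<bar>)"
  shows "(\<forall>x. spectral_term M X x summable_on UNIV)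
    \<and> (\<forall>p x. spectral_term M (moving_average a \<nu> p) x summable_on UNIV)
    \<and> spectral_density M X \<in> L2 (restrict_space lborel {-1/2..1/2})
    \<and> (\<forall>p. spectral_density M (moving_average a \<nu> p) \<in> L2 (restrict_space lborel {-1/2..1/2}))
    \<and> (\<lambda>p. sqrt (LBINT x:{-1/2..1/2}.
          (cmod (spectral_density M X x - spectral_density M (moving_average a \<nu> p) x))\<^sup>2)) \<longlonglongrightarrow> 0"
proof -
  note a = assms(8)
  have X: "X n \<in> L2 M" for n
    using assms(2) unfolding wide_sense_stationary_def by blast
  have \<nu>: "\<nu> n \<in> L2 M" for n
    using innovation_in_past_space[OF assms(5) X] unfolding past_space_def by blast
  have orth: "(\<integral>\<omega>. \<nu> m \<omega> * \<nu> n \<omega> \<partial>M) = (if m = n then 1 else 0)" for m n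
    using innovations_orthogonal[OF assms(5) X, of m n] assms(6)[of n]
    by (simp add: power2_eq_square)
  have ap: "summable (\<lambda>k. \<bar>truncate_seq p a k\<bar>)" for p
    by (rule summable_comparison_test'[OF a]) auto
  have SX: "spectral_term M X x summable_on UNIV"
    "spectral_density M X = (\<lambda>x. complex_of_real ((cmod (transfer_function a x))\<^sup>2))" for x
    using spectral_density_eq_transfer_function[OF a covariance_Wold[OF \<nu> X orth assms(7) a]]
    by auto
  have cov_p: "covariance_seq M (moving_average a \<nu> p) k = autocorrelation (truncate_seq p a) k" for p k
    by (simp only: covariance_moving_average[OF \<nu> orth] autocorrelation_truncate)
  have Sp: "spectral_term M (moving_average a \<nu> p) x summable_on UNIV"
    "spectral_density M (moving_average a \<nu> p)
      = (\<lambda>x. complex_of_real ((cmod (transfer_function (truncate_seq p a) x))\<^sup>2))" for p x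
    using spectral_density_eq_transfer_function[OF ap cov_p] by auto
  define B where "B p = (\<Sum>k. \<bar>a k - truncate_seq p a k\<bar>) * (2 * (\<Sum>k. \<bar>a k\<bar>))" for p
  have bound: "\<bar>cmod (spectral_density M X x - spectral_density M (moving_average a \<nu> p) x)\<bar> \<le> B p"
    for p x
  proof -
    have le: "(\<Sum>k. \<bar>truncate_seq p a k\<bar>) \<le> (\<Sum>k. \<bar>a k\<bar>)"
      by (rule suminf_le[OF _ ap a]) auto
    have d: "summable (\<lambda>k. \<bar>a k - truncate_seq p a k\<bar>)"
      by (rule summable_comparison_test'[OF a]) auto
    have "\<bar>cmod (spectral_density M X x - spectral_density M (moving_average a \<nu> p) x)\<bar>
        = \<bar>(cmod (transfer_function a x))\<^sup>2 - (cmod (transfer_function (truncate_seq p a) x))\<^sup>2\<bar>"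
      unfolding SX(2) Sp(2) of_real_diff[symmetric] norm_of_real by simp
    also have "\<dots> \<le> (\<Sum>k. \<bar>a k - truncate_seq p a k\<bar>)
        * ((\<Sum>k. \<bar>a k\<bar>) + (\<Sum>k. \<bar>truncate_seq p a k\<bar>))"
      by (rule power_spectrum_diff_le[OF a ap])
    also have "\<dots> \<le> B p"
      unfolding B_def using le d by (intro mult_left_mono suminf_nonneg) auto
    finally show ?thesis .
  qed
  have "B \<longlonglongrightarrow> 0"
    unfolding B_def by (rule tendsto_mult_left_zero[OF truncation_tail_tendsto_0[OF a]])
  then have "(\<lambda>p. sqrt (LBINT x:{-1/2..1/2}.
      (cmod (spectral_density M X x - spectral_density M (moving_average a \<nu> p) x))\<^sup>2)) \<longlonglongrightarrow> 0"
  proof (rule tendsto_sandwich[OF _ _ tendsto_const, rotated 2])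
    show "\<forall>\<^sub>F p in sequentially. 0 \<le> sqrt (LBINT x:{-1/2..1/2}.
        (cmod (spectral_density M X x - spectral_density M (moving_average a \<nu> p) x))\<^sup>2)"
      by (auto simp: set_lebesgue_integral_def intro!: always_eventually)
    show "\<forall>\<^sub>F p in sequentially. sqrt (LBINT x:{-1/2..1/2}.
        (cmod (spectral_density M X x - spectral_density M (moving_average a \<nu> p) x))\<^sup>2) \<le> B p"
      using bound by (intro always_eventually allI sqrt_integral_unit_interval_le)
  qed
  then show ?thesis
    by (intro conjI allI SX(1) Sp(1) spectral_density_L2[OF a SX(2)] spectral_density_L2[OF ap Sp(2)])
qed

end
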